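(* Let $G=\bigoplus_{\alpha\in I}G_\alpha$, where $I$ is an arbitrary index set and each $G_\alpha$ is an Abelian group admitting a Hausdorff minimally almost periodic group topology. Then $G$ also admits a Hausdorff minimally almost periodic group topology.
   Context: A topological Abelian group $X$ (or its topology) is minimally almost periodic (MinAP) if its von Neumann radical $\mathbf{n}(X)=\bigcap_{\chi\in X^\wedge}\ker\chi$ equals $X$, where $X^\wedge$ is the group of continuous characters (continuous homomorphisms to the circle group). *)

theory Defs
  imports "HOL-Analysis.Analysis" "HOL-Algebra.Product_Groups"
begin

text \<open>Following the library's abstract topologies, a topology on a group with carrier set is a
  \<^typ>\<open>'a topology\<close> whose underlying space is that carrier.\<close>

definition topological_comm_group :: "('a, 'b) monoid_scheme \<Rightarrow> 'a topology \<Rightarrow> bool" where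
  "topological_comm_group X T \<longleftrightarrow>
     comm_group X \<and> topspace T = carrier X \<and>
     continuous_map (prod_topology T T) T (\<lambda>(x, y). x \<otimes>\<^bsub>X\<^esub> y) \<and>
     continuous_map T T (\<lambda>x. inv\<^bsub>X\<^esub> x)"

definition circle_group :: "complex monoid" where
  "circle_group = \<lparr>carrier = sphere 0 1, mult = (*), one = 1\<rparr>"

text \<open>As usual for \<^const>\<open>hom\<close>, the values of a character outside the carrier are unconstrained.\<close>

definition characters :: "('a, 'b) monoid_scheme \<Rightarrow> 'a topology \<Rightarrow> ('a \<Rightarrow> complex) set" where
  "characters X T =
     {\<phi> \<in> hom X circle_group. continuous_map T (top_of_set (carrier circle_group)) \<phi>}"

definition von_neumann_radical :: "('a, 'b) monoid_scheme \<Rightarrow> 'a topology \<Rightarrow> 'a set" where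
  "von_neumann_radical X T = (\<Inter>\<phi> \<in> characters X T. kernel X circle_group \<phi>)"

definition minimally_almost_periodic :: "('a, 'b) monoid_scheme \<Rightarrow> 'a topology \<Rightarrow> bool" where
  "minimally_almost_periodic X T \<longleftrightarrow>
     topological_comm_group X T \<and> von_neumann_radical X T = carrier X"

end

theory Submission
  imports Defs
begin

text \<open>The direct sum carries the topology it inherits from the Tychonoff product of Hausdorff
  minimally almost periodic topologies on the summands. Group operations are computed
  coordinatewise, so this is a group topology, and it is Hausdorff as a subspace of a product of
  Hausdorff spaces.

  Each embedding \<open>G k \<rightarrow> \<Oplus>i. G i\<close> is a homomorphism that is continuous for this topology, as
  its coordinates are the identity and constant maps. A continuous character of the sum
  therefore pulls back to a continuous character of every summand, where it must be trivial.
  The images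
  of the embeddings generate the direct sum because supports are finite (\<open>sum_group_induct\<close>), so
  the character is trivial on the whole sum.\<close>

definition direct_sum_topology ::
  "'i set \<Rightarrow> ('i \<Rightarrow> ('a, 'b) monoid_scheme) \<Rightarrow> ('i \<Rightarrow> 'a topology) \<Rightarrow> ('i \<Rightarrow> 'a) topology" where
  "direct_sum_topology I G T = subtopology (product_topology T I) (carrier (sum_group I G))"

definition summand_embedding ::
  "'i set \<Rightarrow> ('i \<Rightarrow> ('a, 'b) monoid_scheme) \<Rightarrow> 'i \<Rightarrow> 'a \<Rightarrow> 'i \<Rightarrow> 'a" where
  "summand_embedding I G k a = (\<lambda>i\<in>I. if i = k then a else \<one>\<^bsub>G i\<^esub>)"

lemma comm_group_sum_group:
  assumes "\<And>i. i \<in> I \<Longrightarrow> comm_group (G i)"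
  shows "comm_group (sum_group I G)"
proof (rule group.group_comm_groupI)
  have grp: "\<And>i. i \<in> I \<Longrightarrow> group (G i)"
    using assms by (simp add: comm_group_def)
  then show "group (sum_group I G)"
    by simp
  show "x \<otimes>\<^bsub>sum_group I G\<^esub> y = y \<otimes>\<^bsub>sum_group I G\<^esub> x"
    if "x \<in> carrier (sum_group I G)" "y \<in> carrier (sum_group I G)" for x y
  proof -
    have "x i \<otimes>\<^bsub>G i\<^esub> y i = y i \<otimes>\<^bsub>G i\<^esub> x i" if i: "i \<in> I" for i
    proof -
      interpret comm_group "G i"
        using assms i by blast
      show ?thesis
        using \<open>x \<in> _\<close> \<open>y \<in> _\<close> i grp by (intro m_comm) (auto simp: carrier_sum_group)
    qed
    then show ?thesis
      by (simp cong: restrict_cong)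
  qed
qed

lemma summand_embedding_closed:
  assumes "\<And>i. i \<in> I \<Longrightarrow> group (G i)" "k \<in> I" "a \<in> carrier (G k)"
  shows "summand_embedding I G k a \<in> carrier (sum_group I G)"
proof -
  have "{i \<in> I. summand_embedding I G k a i \<noteq> \<one>\<^bsub>G i\<^esub>} \<subseteq> {k}"
    by (auto simp: summand_embedding_def)
  then have "finite {i \<in> I. summand_embedding I G k a i \<noteq> \<one>\<^bsub>G i\<^esub>}"
    using finite_subset by blast
  then show ?thesis
    using assms
    by (auto simp: carrier_sum_group summand_embedding_def group.is_monoid)
qed

lemma summand_embedding_hom:
  assumes "\<And>i. i \<in> I \<Longrightarrow> group (G i)" "k \<in> I"
  shows "summand_embedding I G k \<in> hom (G k) (sum_group I G)"
proof (rule homI)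
  fix a b
  assume ab: "a \<in> carrier (G k)" "b \<in> carrier (G k)"
  have "summand_embedding I G k (a \<otimes>\<^bsub>G k\<^esub> b) i
      = (summand_embedding I G k a \<otimes>\<^bsub>sum_group I G\<^esub> summand_embedding I G k b) i" for i
    using assms(1)[of i] group.is_monoid[of "G i"]
    by (cases "i \<in> I") (auto simp: summand_embedding_def)
  then show "summand_embedding I G k (a \<otimes>\<^bsub>G k\<^esub> b)
      = summand_embedding I G k a \<otimes>\<^bsub>sum_group I G\<^esub> summand_embedding I G k b"
    by blast
qed (rule summand_embedding_closed[OF assms])

text \<open>The embedded summands generate the direct sum. An element with nonempty support is split
  into one of its coordinates and an element whose support has one index less.\<close>

lemma sum_group_induct [consumes 1, case_names group one mult]:
  assumes x: "x \<in> carrier (sum_group I G)"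
    and grp: "\<And>i. i \<in> I \<Longrightarrow> group (G i)"
    and one: "P \<one>\<^bsub>sum_group I G\<^esub>"
    and mult: "\<And>k a y. \<lbrakk>k \<in> I; a \<in> carrier (G k); y \<in> carrier (sum_group I G); P y\<rbrakk>
      \<Longrightarrow> P (summand_embedding I G k a \<otimes>\<^bsub>sum_group I G\<^esub> y)"
  shows "P x"
proof -
  define supp where "supp x = {i \<in> I. x i \<noteq> \<one>\<^bsub>G i\<^esub>}" for x
  have "finite (supp x)"
    using x grp by (simp add: supp_def carrier_sum_group)
  then show ?thesis
    using x
  proof (induction "supp x" arbitrary: x rule: finite_psubset_induct)
    case psubset
    have x: "x \<in> (\<Pi>\<^sub>E i\<in>I. carrier (G i))"
      using psubset.prems grp by (simp add: carrier_sum_group)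
    show ?case
    proof (cases "supp x = {}")
      case True
      then have "x = \<one>\<^bsub>sum_group I G\<^esub>"
        using x by (auto simp: supp_def PiE_iff extensional_def fun_eq_iff)
      then show ?thesis
        using one by simp
    next
      case False
      then obtain k where k: "k \<in> supp x"
        by blast
      then have kI: "k \<in> I"
        by (simp add: supp_def)
      define y where "y = x(k := \<one>\<^bsub>G k\<^esub>)"
      have supp_y: "supp y \<subset> supp x"
        using k by (auto simp: supp_def y_def)
      then have "finite (supp y)"
        using psubset.hyps(1) finite_subset by blast
      moreover have "y \<in> (\<Pi>\<^sub>E i\<in>I. carrier (G i))"
        using x kI grp by (auto simp: y_def PiE_iff extensional_def group.is_monoid)
      ultimately have y: "y \<in> carrier (sum_group I G)"
        using grp by (simp add: carrier_sum_group supp_def)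
      have "x i = (summand_embedding I G k (x k) \<otimes>\<^bsub>sum_group I G\<^esub> y) i" for i
      proof (cases "i \<in> I")
        case True
        then have "x i \<in> carrier (G i)" "monoid (G i)"
          using x grp by (auto simp: group.is_monoid)
        then show ?thesis
          using True by (cases "i = k") (auto simp: summand_embedding_def y_def)
      qed (use x in \<open>auto simp: PiE_iff extensional_def\<close>)
      then have "x = summand_embedding I G k (x k) \<otimes>\<^bsub>sum_group I G\<^esub> y"
        by blast
      moreover have "x k \<in> carrier (G k)"
        using x kI by auto
      ultimately show ?thesis
        using mult[OF kI _ y psubset.hyps(2)[OF supp_y y]] by metis
    qed
  qed
qed

lemma topspace_direct_sum_topology:
  assumes "\<And>i. i \<in> I \<Longrightarrow> group (G i)" "\<And>i. i \<in> I \<Longrightarrow> topspace (T i) = carrier (G i)"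
  shows "topspace (direct_sum_topology I G T) = carrier (sum_group I G)"
proof -
  have "carrier (sum_group I G) \<subseteq> (\<Pi>\<^sub>E i\<in>I. topspace (T i))"
    using assms by (auto simp: carrier_sum_group cong: PiE_cong)
  then show ?thesis
    by (simp add: direct_sum_topology_def inf_absorb2)
qed

lemma continuous_map_direct_sum_coordinate:
  "k \<in> I \<Longrightarrow> continuous_map (direct_sum_topology I G T) (T k) (\<lambda>x. x k)"
  unfolding direct_sum_topology_def
  by (intro continuous_map_from_subtopology continuous_map_product_projection)

lemma continuous_map_into_direct_sum:
  assumes "\<And>x. x \<in> topspace Z \<Longrightarrow> f x \<in> carrier (sum_group I G)"
    and "\<And>i. i \<in> I \<Longrightarrow> group (G i)"
    and "\<And>i. i \<in> I \<Longrightarrow> continuous_map Z (T i) (\<lambda>x. f x i)"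
  shows "continuous_map Z (direct_sum_topology I G T) f"
proof -
  have "f ` topspace Z \<subseteq> extensional I"
    using assms(1,2) by (auto simp: carrier_sum_group PiE_iff)
  then show ?thesis
    using assms(1,3)
    by (simp add: direct_sum_topology_def continuous_map_in_subtopology
        continuous_map_componentwise Pi_iff)
qed

lemma topological_comm_group_direct_sum:
  assumes "\<And>i. i \<in> I \<Longrightarrow> topological_comm_group (G i) (T i)"
  shows "topological_comm_group (sum_group I G) (direct_sum_topology I G T)"
proof -
  let ?S = "sum_group I G" and ?T = "direct_sum_topology I G T"
  have comm: "comm_group (G i)" and top: "topspace (T i) = carrier (G i)"
    and mult: "continuous_map (prod_topology (T i) (T i)) (T i) (\<lambda>(x, y). x \<otimes>\<^bsub>G i\<^esub> y)"
    and inv: "continuous_map (T i) (T i) (\<lambda>x. inv\<^bsub>G i\<^esub> x)" if "i \<in> I" for i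
    using assms[OF that] by (auto simp: topological_comm_group_def)
  have grp: "group (G i)" if "i \<in> I" for i
    using comm[OF that] by (simp add: comm_group_def)
  interpret S: comm_group ?S
    using comm by (rule comm_group_sum_group)
  have topS: "topspace ?T = carrier ?S"
    using grp top by (rule topspace_direct_sum_topology)
  have "continuous_map (prod_topology ?T ?T) ?T (\<lambda>(x, y). x \<otimes>\<^bsub>?S\<^esub> y)"
  proof (rule continuous_map_into_direct_sum)
    fix i assume i: "i \<in> I"
    have coord: "continuous_map ?T (T i) (\<lambda>x. x i)"
      using i by (rule continuous_map_direct_sum_coordinate)
    have "continuous_map (prod_topology ?T ?T) (prod_topology (T i) (T i)) (\<lambda>p. (fst p i, snd p i))"
      using continuous_map_compose[OF continuous_map_fst coord]
        continuous_map_compose[OF continuous_map_snd coord]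
      by (intro continuous_map_pairedI) (simp_all add: o_def)
    from continuous_map_compose[OF this mult[OF i]]
    show "continuous_map (prod_topology ?T ?T) (T i) (\<lambda>p. (case p of (x, y) \<Rightarrow> x \<otimes>\<^bsub>?S\<^esub> y) i)"
      using i by (simp add: o_def case_prod_unfold)
  qed (use S.m_closed grp topS in \<open>auto simp del: mult_sum_group\<close>)
  moreover have "continuous_map ?T ?T (\<lambda>x. inv\<^bsub>?S\<^esub> x)"
  proof (rule continuous_map_into_direct_sum)
    fix i assume i: "i \<in> I"
    have "continuous_map ?T (T i) (\<lambda>x. inv\<^bsub>G i\<^esub> x i)"
      using continuous_map_compose[OF continuous_map_direct_sum_coordinate[OF i, of G T] inv[OF i]]
      by (simp add: o_def)
    then show "continuous_map ?T (T i) (\<lambda>x. (inv\<^bsub>?S\<^esub> x) i)"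
      by (rule continuous_map_eq) (use i grp topS in simp)
  qed (use S.inv_closed grp topS in auto)
  ultimately show ?thesis
    using topS S.comm_group_axioms by (simp add: topological_comm_group_def)
qed

lemma continuous_map_summand_embedding:
  assumes "\<And>i. i \<in> I \<Longrightarrow> group (G i)" "\<And>i. i \<in> I \<Longrightarrow> topspace (T i) = carrier (G i)" "k \<in> I"
  shows "continuous_map (T k) (direct_sum_topology I G T) (summand_embedding I G k)"
proof (rule continuous_map_into_direct_sum)
  show "summand_embedding I G k a \<in> carrier (sum_group I G)" if "a \<in> topspace (T k)" for a
  proof (rule summand_embedding_closed[OF assms(1) assms(3)])
    show "a \<in> carrier (G k)"
      using that assms(2)[OF assms(3)] by simp
  qed
  show "continuous_map (T k) (T i) (\<lambda>a. summand_embedding I G k a i)" if "i \<in> I" for i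
    using that assms
    by (cases "i = k") (auto simp: summand_embedding_def group.is_monoid)
qed (rule assms(1))

lemma character_one:
  assumes "\<phi> \<in> hom X circle_group" "group X"
  shows "\<phi> \<one>\<^bsub>X\<^esub> = 1"
proof -
  interpret group X by fact
  have "\<phi> \<one>\<^bsub>X\<^esub> * \<phi> \<one>\<^bsub>X\<^esub> = \<phi> \<one>\<^bsub>X\<^esub>"
    using hom_mult[OF assms(1), of "\<one>\<^bsub>X\<^esub>" "\<one>\<^bsub>X\<^esub>"] by (simp add: circle_group_def)
  moreover have "\<phi> \<one>\<^bsub>X\<^esub> \<noteq> 0"
    using hom_in_carrier[OF assms(1), of "\<one>\<^bsub>X\<^esub>"] by (auto simp: circle_group_def)
  ultimately show ?thesis by simp
qed

lemma characters_compose: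
  assumes "\<phi> \<in> characters Y U" "f \<in> hom X Y" "continuous_map T U f"
  shows "\<phi> \<circ> f \<in> characters X T"
  unfolding characters_def mem_Collect_eq
proof
  show "\<phi> \<circ> f \<in> hom X circle_group"
    using assms(1,2) by (simp add: characters_def hom_compose)
  show "continuous_map T (top_of_set (carrier circle_group)) (\<phi> \<circ> f)"
    by (rule continuous_map_compose[OF assms(3)]) (use assms(1) in \<open>simp add: characters_def\<close>)
qed

text \<open>The trivial character guarantees that the intersection defining the radical is taken over
  a nonempty family, and hence that it lies inside the carrier.\<close>

lemma von_neumann_radical_eq_carrier_iff:
  "von_neumann_radical X T = carrier X \<longleftrightarrow> (\<forall>\<phi> \<in> characters X T. \<forall>x \<in> carrier X. \<phi> x = 1)"
proof -
  have "(\<lambda>_. 1) \<in> characters X T"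
    by (auto simp: characters_def hom_def circle_group_def)
  then have "von_neumann_radical X T = {x \<in> carrier X. \<forall>\<phi> \<in> characters X T. \<phi> x = 1}"
    by (auto simp: von_neumann_radical_def kernel_def circle_group_def)
  moreover have "{x \<in> A. \<forall>\<phi> \<in> B. R \<phi> x} = A \<longleftrightarrow> (\<forall>\<phi> \<in> B. \<forall>x \<in> A. R \<phi> x)"
    for A :: "'a set" and B :: "('a \<Rightarrow> complex) set" and R
    by blast
  ultimately show ?thesis
    by simp
qed

lemma minimally_almost_periodic_direct_sum:
  assumes "\<And>i. i \<in> I \<Longrightarrow> minimally_almost_periodic (G i) (T i)"
  shows "minimally_almost_periodic (sum_group I G) (direct_sum_topology I G T)"
proof -
  let ?S = "sum_group I G" and ?T = "direct_sum_topology I G T"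
  have tcg: "topological_comm_group (G i) (T i)"
    and trivial: "\<And>\<psi> a. \<psi> \<in> characters (G i) (T i) \<Longrightarrow> a \<in> carrier (G i) \<Longrightarrow> \<psi> a = 1"
    if "i \<in> I" for i
    using assms[OF that]
    by (auto simp: minimally_almost_periodic_def von_neumann_radical_eq_carrier_iff)
  have grp: "group (G i)" and top: "topspace (T i) = carrier (G i)" if "i \<in> I" for i
    using tcg[OF that] by (auto simp: topological_comm_group_def comm_group_def)
  have "\<phi> x = 1" if \<phi>: "\<phi> \<in> characters ?S ?T" and x: "x \<in> carrier ?S" for \<phi> x
  proof -
    have hom: "\<phi> \<in> hom ?S circle_group"
      using \<phi> by (simp add: characters_def)
    show ?thesis
      using x
    proof (induction rule: sum_group_induct)
      case (group i)
      then show ?case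
        by (rule grp)
    next
      case one
      show ?case
        by (rule character_one[OF hom]) (use grp in simp)
    next
      case (mult k a y)
      have "\<phi> \<circ> summand_embedding I G k \<in> characters (G k) (T k)"
        using \<phi>
      proof (rule characters_compose)
        show "summand_embedding I G k \<in> hom (G k) ?S"
          using grp \<open>k \<in> I\<close> by (rule summand_embedding_hom)
        show "continuous_map (T k) ?T (summand_embedding I G k)"
          using grp top \<open>k \<in> I\<close> by (rule continuous_map_summand_embedding)
      qed
      then have "\<phi> (summand_embedding I G k a) = 1"
        using trivial mult.hyps by fastforce
      moreover have "summand_embedding I G k a \<in> carrier ?S"
        using grp mult.hyps(1,2) by (rule summand_embedding_closed)
      ultimately show ?case
        using hom_mult[OF hom _ mult.hyps(3)] mult.IH
        by (simp add: circle_group_def del: mult_sum_group)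
    qed
  qed
  then show ?thesis
    using topological_comm_group_direct_sum[of I G T] tcg
    by (simp add: minimally_almost_periodic_def von_neumann_radical_eq_carrier_iff)
qed

theorem proposition4:
  fixes I :: "'i set" and G :: "'i \<Rightarrow> ('a, 'b) monoid_scheme"
  assumes "\<And>i. i \<in> I \<Longrightarrow> comm_group (G i)"
    and "\<And>i. i \<in> I \<Longrightarrow> \<exists>T. Hausdorff_space T \<and> minimally_almost_periodic (G i) T"
  shows "\<exists>T. Hausdorff_space T \<and> minimally_almost_periodic (sum_group I G) T"
proof -
  obtain T where haus: "\<And>i. i \<in> I \<Longrightarrow> Hausdorff_space (T i)"
    and map: "\<And>i. i \<in> I \<Longrightarrow> minimally_almost_periodic (G i) (T i)"
    using bchoice[of I "\<lambda>i T. Hausdorff_space T \<and> minimally_almost_periodic (G i) T"] assms(2)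
    by blast
  have "Hausdorff_space (direct_sum_topology I G T)"
    using haus
    by (simp add: direct_sum_topology_def Hausdorff_space_subtopology Hausdorff_space_product_topology)
  then show ?thesis
    using minimally_almost_periodic_direct_sum[of I G T] map by blast
qed

end
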